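(* Let $(V,E)$ be a $4$-manifold and let $(\Omega,\mathcal{A},\mathrm{P})$ be a probability space of locally injective functions $g:V\to\mathbb{R}$ such that $g\mapsto -g$ is an automorphism of the probability space. Then for every $v\in V$ the index expectation curvature $K(v)=\mathrm{E}[i_g(v)]$ equals the expected genus of the random surface $S_g(v)$ in the $3$-sphere $S(v)$: $$K(v)=\mathrm{E}\left[\,1-\tfrac12\chi(S_g(v))\right].$$
   Context: All graphs are finite simple graphs; $S(v)$ is the subgraph induced by the neighbors of $v$, $G\setminus v$ is the graph with $v$ removed. Contractible graphs: $K_1$ is contractible, and $G$ is contractible if there is a vertex $v$ such that $S(v)$ and $G\setminus v$ are both contractible; the empty graph is not contractible. The empty graph is the $(-1)$-sphere; for $q\ge0$ a $q$-manifold is a graph all of whose unit spheres $S(v)$ are $(q-1)$-spheres, and a $q$-sphere is a $q$-manifold for which there is a vertex $v$ with $G\setminus v$ contractible. The Euler characteristic $\chi$ of a graph is $\sum_x(-1)^{\dim(x)}$ over its non-empty cliques $x$, where $\dim(x)=|x|-1$ (empty graph: $0$). A function $g$ is locally injective if $g(v)\ne g(w)$ for $(v,w)\in E$. The index is $i_g(v)=1-\chi(S_g^-(v))$, where $S_g^-(v)$ is the subgraph induced by the neighbors $w$ of $v$ with $g(w)<g(v)$. The surface $S_g(v)$ is the graph whose vertices are the non-empty cliques $x$ of $S(v)$ on which $w\mapsto\mathrm{sign}(g(w)-g(v))$ takes both values $-1$ and $1$, two distinct such cliques being adjacent iff one contains the other. The genus of a surface with Euler characteristic $\chi$ is defined by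 $\chi=2-2\cdot\mathrm{genus}$. All these quantities are random variables on $\Omega$; $\mathrm{E}$ is expectation with respect to $\mathrm{P}$. *)

theory Defs
  imports "Graph_Theory.Pair_Digraph" "HOL-Probability.Probability"
begin

text \<open>
  A finite simple graph is a \<open>pair_pre_digraph\<close> satisfying \<open>pair_graph\<close>: finite, symmetric and
  loop-free, with all arcs between vertices.
\<close>

definition induced :: "'a pair_pre_digraph \<Rightarrow> 'a set \<Rightarrow> 'a pair_pre_digraph" where
  "induced G W = \<lparr>pverts = pverts G \<inter> W, parcs = parcs G \<inter> W \<times> W\<rparr>"

definition neighbors :: "'a pair_pre_digraph \<Rightarrow> 'a \<Rightarrow> 'a set" where
  "neighbors G v = {w. (v, w) \<in> parcs G}"

definition unit_sphere :: "'a pair_pre_digraph \<Rightarrow> 'a \<Rightarrow> 'a pair_pre_digraph" where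
  "unit_sphere G v = induced G (neighbors G v)"

definition remove_vertex :: "'a pair_pre_digraph \<Rightarrow> 'a \<Rightarrow> 'a pair_pre_digraph" where
  "remove_vertex G v = induced G (- {v})"

inductive contractible_graph :: "'a pair_pre_digraph \<Rightarrow> bool" where
  K1: "pair_graph G \<Longrightarrow> card (pverts G) = 1 \<Longrightarrow> contractible_graph G"
| step: "pair_graph G \<Longrightarrow> v \<in> pverts G \<Longrightarrow> contractible_graph (unit_sphere G v)
    \<Longrightarrow> contractible_graph (remove_vertex G v) \<Longrightarrow> contractible_graph G"

inductive graph_manifold :: "int \<Rightarrow> 'a pair_pre_digraph \<Rightarrow> bool"
  and graph_sphere :: "int \<Rightarrow> 'a pair_pre_digraph \<Rightarrow> bool" where
  manifold: "pair_graph G \<Longrightarrow> 0 \<le> q \<Longrightarrow> (\<And>v. v \<in> pverts G \<Longrightarrow> graph_sphere (q - 1) (unit_sphere G v))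
    \<Longrightarrow> graph_manifold q G"
| empty_sphere: "pair_graph G \<Longrightarrow> pverts G = {} \<Longrightarrow> graph_sphere (- 1) G"
| sphere: "graph_manifold q G \<Longrightarrow> v \<in> pverts G \<Longrightarrow> contractible_graph (remove_vertex G v)
    \<Longrightarrow> graph_sphere q G"

definition cliques :: "'a pair_pre_digraph \<Rightarrow> 'a set set" where
  "cliques G = {x. x \<noteq> {} \<and> x \<subseteq> pverts G \<and> (\<forall>u\<in>x. \<forall>w\<in>x. u \<noteq> w \<longrightarrow> (u, w) \<in> parcs G)}"

definition euler_char :: "'a pair_pre_digraph \<Rightarrow> int" where
  "euler_char G = (\<Sum>x\<in>cliques G. (- 1) ^ (card x - 1))"

definition locally_injective :: "'a pair_pre_digraph \<Rightarrow> ('a \<Rightarrow> real) \<Rightarrow> bool" where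
  "locally_injective G g \<longleftrightarrow> (\<forall>(v, w)\<in>parcs G. g v \<noteq> g w)"

text \<open>
  A function on the vertex set is represented by its unique extension that is \<open>undefined\<close>
  outside, so that distinct points of the sample space are distinct functions on the vertices.
\<close>

definition locally_injective_functions :: "'a pair_pre_digraph \<Rightarrow> ('a \<Rightarrow> real) set" where
  "locally_injective_functions G = {g \<in> pverts G \<rightarrow>\<^sub>E UNIV. locally_injective G g}"

definition negate_on :: "'a set \<Rightarrow> ('a \<Rightarrow> real) \<Rightarrow> ('a \<Rightarrow> real)" where
  "negate_on V g = (\<lambda>v\<in>V. - g v)"

definition measure_automorphism :: "'b measure \<Rightarrow> ('b \<Rightarrow> 'b) \<Rightarrow> bool" where
  "measure_automorphism M T \<longleftrightarrow> bij_betw T (space M) (space M) \<and> T \<in> measurable M M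
    \<and> inv_into (space M) T \<in> measurable M M \<and> distr M M T = M"

definition lower_sphere :: "'a pair_pre_digraph \<Rightarrow> ('a \<Rightarrow> real) \<Rightarrow> 'a \<Rightarrow> 'a pair_pre_digraph" where
  "lower_sphere G g v = induced G {w \<in> neighbors G v. g w < g v}"

definition index :: "'a pair_pre_digraph \<Rightarrow> ('a \<Rightarrow> real) \<Rightarrow> 'a \<Rightarrow> int" where
  "index G g v = 1 - euler_char (lower_sphere G g v)"

definition level_surface :: "'a pair_pre_digraph \<Rightarrow> ('a \<Rightarrow> real) \<Rightarrow> 'a \<Rightarrow> 'a set pair_pre_digraph" where
  "level_surface G g v =
    (let X = {x \<in> cliques (unit_sphere G v). {- 1, 1} \<subseteq> (\<lambda>w. sgn (g w - g v)) ` x}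
     in \<lparr>pverts = X, parcs = {(x, y) \<in> X \<times> X. x \<noteq> y \<and> (x \<subseteq> y \<or> y \<subseteq> x)}\<rparr>)"

text \<open>
  The solution of \<open>\<chi> = 2 - 2 * genus\<close>; real-valued, since \<open>\<chi>\<close> need not be even for an arbitrary graph.
\<close>

definition genus :: "'a pair_pre_digraph \<Rightarrow> real" where
  "genus G = 1 - euler_char G / 2"

definition index_expectation :: "'a pair_pre_digraph \<Rightarrow> ('a \<Rightarrow> real) measure \<Rightarrow> 'a \<Rightarrow> real" where
  "index_expectation G M v = prob_space.expectation M (\<lambda>g. index G g v)"

end

theory Submission
  imports Defs
begin

text \<open>
  Split the 3-sphere \<open>S(v)\<close> into the vertices below and above \<open>g(v)\<close>. Counting each chain of mixed
  cliques by its least element writes \<open>\<chi>(S\<^sub>g(v))\<close> as a sum over mixed cliques \<open>x\<close> of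
  \<open>1 - \<chi>\<close> of the link of \<open>x\<close>, which is a sphere of dimension \<open>3 - |x|\<close>, so that \<open>x\<close> contributes
  \<open>(-1)\<^bsup>|x|\<^esup>\<close>. As \<open>\<chi>(S(v)) = 0\<close>, the sum over mixed cliques is \<open>\<chi>(S\<^sub>g\<^sup>-(v)) + \<chi>(S\<^sub>-\<^sub>g\<^sup>-(v))\<close>.
  Hence \<open>i\<^sub>g(v) + i\<^sub>-\<^sub>g(v) = 2 - \<chi>(S\<^sub>g(v))\<close> pointwise, and both indices have the same expectation.
\<close>

subsection \<open>Signed clique sums\<close>

lemma pair_graph_sym:
  assumes "pair_graph G" and "(u, w) \<in> parcs G"
  shows "(w, u) \<in> parcs G"
proof -
  interpret pair_graph G by fact
  show ?thesis using assms(2) by (rule arcs_symmetric)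
qed

lemma pair_graph_irrefl:
  assumes "pair_graph G"
  shows "(u, u) \<notin> parcs G"
proof -
  interpret pair_graph G by fact
  show ?thesis using pair_no_loops by fastforce
qed

lemma pair_graph_head_in_verts:
  assumes "pair_graph G" and "(u, w) \<in> parcs G"
  shows "w \<in> pverts G"
proof -
  interpret pair_graph G by fact
  show ?thesis using assms(2) by (rule in_arcsD2)
qed

lemma pair_graph_finite_verts: "pair_graph G \<Longrightarrow> finite (pverts G)"
  by (simp add: pair_graph_def pair_digraph_def pair_fin_digraph_def pair_fin_digraph_axioms_def)

lemma pair_graphI:
  assumes "finite (pverts G)" and "parcs G \<subseteq> pverts G \<times> pverts G"
    and "sym (parcs G)" and "irrefl (parcs G)"
  shows "pair_graph G"
proof unfold_locales
  show "finite (parcs G)"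
    using assms(1,2) by (meson finite_SigmaI finite_subset)
  show "symmetric (with_proj G)"
    using assms(3) by (simp add: symmetric_def)
qed (use assms in \<open>auto simp: irrefl_def\<close>)

text \<open>Unlike \<^const>\<open>cliques\<close>, these include the empty set.\<close>

definition faces :: "'a pair_pre_digraph \<Rightarrow> 'a set set" where
  "faces G = {x. x \<subseteq> pverts G \<and> pairwise (\<lambda>u w. (u, w) \<in> parcs G) x}"

text \<open>For \<open>x = {}\<close> this is \<open>1 - \<chi>(G)\<close>.\<close>

definition star_sum :: "'a pair_pre_digraph \<Rightarrow> 'a set \<Rightarrow> int" where
  "star_sum G x = (\<Sum>y | y \<in> faces G \<and> x \<subseteq> y. (- 1) ^ card y)"

lemma cliques_eq_faces: "cliques G = faces G - {{}}"
  by (auto simp: cliques_def faces_def pairwise_def)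

lemma empty_in_faces: "{} \<in> faces G"
  by (simp add: faces_def)

lemma finite_faces: "finite (pverts G) \<Longrightarrow> finite (faces G)"
  by (rule finite_subset[of _ "Pow (pverts G)"]) (auto simp: faces_def)

lemma finite_face: "finite (pverts G) \<Longrightarrow> x \<in> faces G \<Longrightarrow> finite x"
  by (auto simp: faces_def intro: finite_subset)

lemma faces_induced: "faces (induced G W) = {x \<in> faces G. x \<subseteq> W}"
  by (auto simp: faces_def induced_def pairwise_def)

lemma faces_unit_sphere: "faces (unit_sphere G v) = {x \<in> faces G. \<forall>w\<in>x. (v, w) \<in> parcs G}"
  by (auto simp: unit_sphere_def faces_induced neighbors_def)

lemma star_sum_empty: "star_sum G {} = (\<Sum>y\<in>faces G. (- 1) ^ card y)"
  by (simp add: star_sum_def)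

lemma euler_char_eq_star_sum:
  assumes "finite (pverts G)"
  shows "euler_char G = 1 - star_sum G {}"
proof -
  have "euler_char G = (\<Sum>x\<in>faces G - {{}}. - ((- 1) ^ card x))"
    unfolding euler_char_def cliques_eq_faces
  proof (rule sum.cong[OF refl])
    fix x assume "x \<in> faces G - {{}}"
    then have "card x > 0"
      using finite_face[OF assms] by (simp add: card_gt_0_iff)
    then show "(- 1) ^ (card x - 1) = - ((- 1 :: int) ^ card x)"
      by (cases "card x") auto
  qed
  also have "\<dots> = 1 - (\<Sum>x\<in>faces G. (- 1) ^ card x)"
    by (simp add: sum.remove[OF finite_faces[OF assms] empty_in_faces] sum_negf)
  finally show ?thesis by (simp add: star_sum_empty)
qed

text \<open>Deleting \<open>v\<close> maps the faces containing \<open>x\<close> bijectively onto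
  the faces of the link of \<open>v\<close> containing \<open>x - {v}\<close>. Each size drops by
  one, whence the sign.\<close>

lemma star_sum_unit_sphere:
  assumes G: "pair_graph G" and v: "v \<in> pverts G" "v \<in> x"
  shows "star_sum G x = - star_sum (unit_sphere G v) (x - {v})"
proof -
  let ?L = "{z \<in> faces (unit_sphere G v). x - {v} \<subseteq> z}"
  have v_notin: "v \<notin> z" if "z \<in> ?L" for z
    using that pair_graph_irrefl[OF G] by (auto simp: faces_unit_sphere)
  have "{y \<in> faces G. x \<subseteq> y} = insert v ` ?L"
  proof (intro subset_antisym subsetI)
    fix y assume y: "y \<in> {y \<in> faces G. x \<subseteq> y}"
    with v have "v \<in> y" by blast
    with y have "y = insert v (y - {v})" "y - {v} \<in> ?L"
      unfolding faces_unit_sphere by (auto simp: faces_def pairwise_def)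
    then show "y \<in> insert v ` ?L" by blast
  next
    fix y assume "y \<in> insert v ` ?L"
    then show "y \<in> {y \<in> faces G. x \<subseteq> y}"
      using v unfolding faces_unit_sphere
      by (auto simp: faces_def pairwise_insert pair_graph_sym[OF G, of v])
  qed
  moreover have "inj_on (insert v) ?L"
    using v_notin by (intro inj_onI) (metis insert_ident)
  moreover have "(- 1) ^ card (insert v z) = - ((- 1 :: int) ^ card z)" if "z \<in> ?L" for z
  proof -
    have "finite z"
      using that finite_face[OF pair_graph_finite_verts[OF G]]
      by (auto simp: faces_unit_sphere)
    then show ?thesis using v_notin[OF that] by simp
  qed
  ultimately show ?thesis
    by (simp add: star_sum_def sum.reindex sum_negf)
qed

text \<open>Faces avoiding \<open>v\<close> are those of the smaller graph; the remaining ones are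
  handled by \<open>star_sum_unit_sphere\<close> with \<open>x = {v}\<close>.\<close>

lemma star_sum_remove_vertex:
  assumes G: "pair_graph G" and v: "v \<in> pverts G"
  shows "star_sum G {} = star_sum (remove_vertex G v) {} - star_sum (unit_sphere G v) {}"
proof -
  have "faces G = faces (remove_vertex G v) \<union> {y \<in> faces G. {v} \<subseteq> y}"
    by (auto simp: remove_vertex_def faces_induced)
  moreover have "faces (remove_vertex G v) \<inter> {y \<in> faces G. {v} \<subseteq> y} = {}"
    by (auto simp: remove_vertex_def faces_induced)
  moreover have "finite (faces G)"
    by (simp add: finite_faces pair_graph_finite_verts[OF G])
  ultimately have "star_sum G {} = star_sum (remove_vertex G v) {} + star_sum G {v}"
    unfolding star_sum_def by (simp, metis (no_types, lifting) finite_Un sum.union_disjoint)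
  then show ?thesis
    using star_sum_unit_sphere[OF G v, of "{v}"] by simp
qed

subsection \<open>Contractible graphs and spheres\<close>

text \<open>For a single vertex the faces \<open>{}\<close> and \<open>{v}\<close> cancel; in the
  inductive step both terms of \<open>star_sum_remove_vertex\<close> vanish.\<close>

lemma star_sum_contractible:
  "contractible_graph G \<Longrightarrow> star_sum G {} = 0"
proof (induction rule: contractible_graph.induct)
  case (K1 G)
  then obtain v where "pverts G = {v}"
    by (auto simp: card_1_singleton_iff)
  then have "faces G = {{}, {v}}"
    by (auto simp: faces_def)
  then show ?case by (simp add: star_sum_empty)
next
  case (step G v)
  then show ?case by (simp add: star_sum_remove_vertex)
qed

lemma graph_manifoldD:
  assumes "graph_manifold q G"
  shows "pair_graph G" and "0 \<le> q"
    and "\<And>v. v \<in> pverts G \<Longrightarrow> graph_sphere (q - 1) (unit_sphere G v)"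
  using assms by (auto elim: graph_manifold.cases)

text \<open>
  The shadow on Euler characteristics of the fact that the link of a face \<open>x\<close> of a \<open>q\<close>-sphere is
  a \<open>(q - |x|)\<close>-sphere.
\<close>

lemma star_sum_sphere:
  assumes "graph_sphere q G" and "x \<in> faces G"
  shows "star_sum G x = (- 1) ^ nat (q + 1)"
  using assms
\<comment> \<open>Dimensions of spheres are integers starting at -1, hence the shift by one.\<close>
proof (induction "nat (q + 1)" arbitrary: q G x)
  case 0
  from 0(2) show ?case
  proof cases
    case empty_sphere
    then have "faces G = {{}}" by (auto simp: faces_def)
    then show ?thesis using 0 empty_sphere by (simp add: star_sum_def)
  next
    case (sphere v)
    then show ?thesis using 0 graph_manifoldD(2) by force
  qed
next
  case (Suc n)
  from Suc(3) obtain v where man: "graph_manifold q G"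
    and v: "v \<in> pverts G" "contractible_graph (remove_vertex G v)"
    using Suc(2) by cases auto
  have G: "pair_graph G" by (rule graph_manifoldD[OF man])
  have n: "n = nat (q - 1 + 1)" "nat (q + 1) = Suc n"
    using Suc(2) by auto
  have IH: "star_sum (unit_sphere G u) z = (- 1) ^ n"
    if "u \<in> pverts G" "z \<in> faces (unit_sphere G u)" for u z
    using Suc(1)[OF n(1) graph_manifoldD(3)[OF man that(1)] that(2)] n(1) by simp
  show ?case
  \<comment> \<open>For empty \<open>x\<close>, the vertex with contractible complement leaves only
    its unit sphere term; otherwise any vertex of \<open>x\<close> serves. Either way the dimension
    drops by one and a factor -1 appears.\<close>
  proof (cases "x = {}")
    case True
    then show ?thesis
      using v by (simp add: star_sum_remove_vertex[OF G v(1)] star_sum_contractible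
          IH empty_in_faces n(2))
  next
    case False
    then obtain u where u: "u \<in> x" by blast
    with Suc(4) have "u \<in> pverts G" "x - {u} \<in> faces (unit_sphere G u)"
      unfolding faces_unit_sphere by (auto simp: faces_def pairwise_def)
    then show ?thesis
      by (simp add: star_sum_unit_sphere[OF G _ u] IH n(2))
  qed
qed

subsection \<open>Comparability graphs\<close>

text \<open>The level surface is the case of mixed cliques ordered by inclusion.\<close>

definition comparability_graph :: "'a::order set \<Rightarrow> 'a pair_pre_digraph" where
  "comparability_graph X =
    \<lparr>pverts = X, parcs = {(x, y) \<in> X \<times> X. x \<noteq> y \<and> (x \<le> y \<or> y \<le> x)}\<rparr>"

lemma pair_graph_comparability_graph: "finite X \<Longrightarrow> pair_graph (comparability_graph X)"
  by (rule pair_graphI) (auto simp: comparability_graph_def sym_def irrefl_def)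

text \<open>
  The hypothesis says that \<open>h x\<close> is \<open>1 - \<chi>\<close> of the comparability graph of the elements above \<open>x\<close>.
\<close>

lemma star_sum_comparability_graph:
  fixes X :: "'a::order set" and h :: "'a \<Rightarrow> int"
  assumes "finite X" and "\<And>x. x \<in> X \<Longrightarrow> (\<Sum>y | y \<in> X \<and> x \<le> y. h y) = 1"
  shows "star_sum (comparability_graph X) {} = 1 - sum h X"
  using assms
proof (induction X rule: finite_psubset_induct)
  case (psubset X)
  show ?case
  proof (cases "X = {}")
    case True
    then have "faces (comparability_graph X) = {{}}"
      by (auto simp: faces_def comparability_graph_def)
    then show ?thesis using True by (simp add: star_sum_def)
  next
    case False
    \<comment> \<open>All neighbors of a minimal \<open>m\<close> lie above it, and no other element
      has \<open>m\<close> above it. So both \<open>X - {m}\<close> and \<open>?U\<close> inherit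
      the hypothesis on up-sets.\<close>
    with psubset(1) obtain m where m: "m \<in> X" "\<And>y. y \<in> X \<Longrightarrow> y \<le> m \<Longrightarrow> m = y"
      by (metis finite_has_minimal)
    let ?U = "{y \<in> X. m < y}"
    have "remove_vertex (comparability_graph X) m = comparability_graph (X - {m})"
      by (auto simp: remove_vertex_def induced_def comparability_graph_def)
    moreover have "unit_sphere (comparability_graph X) m = comparability_graph ?U"
      using m by (auto simp: unit_sphere_def induced_def comparability_graph_def neighbors_def
          less_le)
    moreover have "star_sum (comparability_graph (X - {m})) {} = 1 - sum h (X - {m})"
    proof (rule psubset(2))
      fix x assume x: "x \<in> X - {m}"
      then have "{y \<in> X - {m}. x \<le> y} = {y \<in> X. x \<le> y}"
        using m by auto
      then show "(\<Sum>y | y \<in> X - {m} \<and> x \<le> y. h y) = 1"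
        using psubset(3)[of x] x by simp
    qed (use m in auto)
    moreover have "star_sum (comparability_graph ?U) {} = 1 - sum h ?U"
    proof (rule psubset(2))
      fix x assume x: "x \<in> ?U"
      then have "{y \<in> ?U. x \<le> y} = {y \<in> X. x \<le> y}"
        by auto
      then show "(\<Sum>y | y \<in> ?U \<and> x \<le> y. h y) = 1"
        using psubset(3)[of x] x by simp
    qed (use m in auto)
    moreover have "h m + sum h ?U = 1"
    proof -
      have "{y \<in> X. m \<le> y} = insert m ?U" using m(1) by auto
      then show ?thesis using psubset(3)[OF m(1)] psubset(1) by simp
    qed
    moreover have "sum h X = h m + sum h (X - {m})"
      using psubset(1) m(1) by (rule sum.remove)
    moreover have "m \<in> pverts (comparability_graph X)"
      using m(1) by (simp add: comparability_graph_def)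
    ultimately show ?thesis
      using star_sum_remove_vertex[OF pair_graph_comparability_graph[OF psubset(1)], of m] by simp
  qed
qed

subsection \<open>The level surface\<close>

lemma euler_char_level_surface:
  assumes G: "pair_graph G" and v: "v \<in> pverts G" and S: "graph_sphere 3 (unit_sphere G v)"
    and g: "locally_injective G g"
  shows "euler_char (level_surface G g v) =
    2 - index G g v - index G (negate_on (pverts G) g) v"
proof -
  let ?S = "unit_sphere G v" and ?h = "\<lambda>x :: 'a set. (- 1 :: int) ^ card x"
  let ?A = "lower_sphere G g v" and ?B = "lower_sphere G (negate_on (pverts G) g) v"
  define X where "X = {x \<in> cliques ?S. {- 1, 1} \<subseteq> (\<lambda>w. sgn (g w - g v)) ` x}"
  have fin: "finite (pverts G)" "finite (pverts ?S)" "finite (pverts ?A)" "finite (pverts ?B)"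
    using pair_graph_finite_verts[OF G] by (auto simp: unit_sphere_def lower_sphere_def induced_def)
  have finX: "finite X"
    using finite_faces[OF fin(2)] by (simp add: X_def cliques_eq_faces)
  have X_iff: "x \<in> X \<longleftrightarrow> x \<in> faces ?S \<and> (\<exists>w\<in>x. g w < g v) \<and> (\<exists>w\<in>x. g v < g w)" for x
  proof -
    have "- 1 \<in> (\<lambda>w. sgn (g w - g v)) ` x \<longleftrightarrow> (\<exists>w\<in>x. g w < g v)"
      by (simp add: image_iff eq_commute[of "- 1"] sgn_1_neg)
    moreover have "1 \<in> (\<lambda>w. sgn (g w - g v)) ` x \<longleftrightarrow> (\<exists>w\<in>x. g v < g w)"
      by (simp add: image_iff eq_commute[of 1] sgn_1_pos)
    ultimately show ?thesis by (auto simp: X_def cliques_eq_faces)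
  qed
  have surface: "level_surface G g v = comparability_graph X"
    by (simp add: level_surface_def comparability_graph_def X_def Let_def)
  have "star_sum (comparability_graph X) {} = 1 - sum ?h X"
  proof (rule star_sum_comparability_graph[OF finX])
    fix x assume x: "x \<in> X"
    \<comment> \<open>A face containing a mixed face is mixed, so the sum over \<open>X\<close> is a
      full \<open>star_sum\<close> in the 3-sphere, with value \<open>(- 1) ^ 4\<close>. This is
      what lets \<open>?h\<close> play the role of \<open>h\<close>.\<close>
    then have "{y \<in> X. x \<subseteq> y} = {y \<in> faces ?S. x \<subseteq> y}"
      by (auto simp: X_iff)
    moreover have "star_sum ?S x = 1"
      using star_sum_sphere[OF S, of x] x by (simp add: X_iff)
    ultimately show "(\<Sum>y | y \<in> X \<and> x \<subseteq> y. ?h y) = 1"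
      by (simp add: star_sum_def)
  qed
  then have surface_sum: "euler_char (level_surface G g v) = sum ?h X"
    using finX by (simp add: surface euler_char_eq_star_sum comparability_graph_def)
  \<comment> \<open>Vertices of \<open>S(v)\<close> are adjacent to \<open>v\<close>, so local
    injectivity excludes the value \<open>g v\<close>.\<close>
  have below_or_above: "g w < g v \<or> g v < g w" if "x \<in> faces ?S" "w \<in> x" for x w
    using that g by (force simp: locally_injective_def faces_unit_sphere)
  have A: "faces ?A = {x \<in> faces ?S. \<forall>w\<in>x. g w < g v}"
    by (auto simp: lower_sphere_def unit_sphere_def faces_induced)
  \<comment> \<open>\<open>negate_on\<close> is \<open>undefined\<close> outside the vertex set;
    here \<open>v\<close> and all vertices of a face lie inside it, so the inequality just
    flips.\<close>
  have B: "faces ?B = {x \<in> faces ?S. \<forall>w\<in>x. g v < g w}"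
    using v unfolding lower_sphere_def unit_sphere_def faces_induced
    by (auto simp: negate_on_def faces_def)
  have "faces ?S = X \<union> (faces ?A \<union> faces ?B)"
    unfolding set_eq_iff A B Un_iff X_iff mem_Collect_eq using below_or_above by blast
  moreover have "X \<inter> (faces ?A \<union> faces ?B) = {}"
    unfolding disjoint_iff A B Un_iff X_iff mem_Collect_eq using less_asym[of "g v"] by blast
  moreover have finAB: "finite (faces ?A)" "finite (faces ?B)"
    by (simp_all add: finite_faces fin)
  ultimately have "sum ?h (faces ?S) = sum ?h X + sum ?h (faces ?A \<union> faces ?B)"
    using finX by (simp add: sum.union_disjoint)
  \<comment> \<open>Only the empty face is both below and above; counting it twice causes the
    correction by 1.\<close>
  moreover have "faces ?A \<inter> faces ?B = {{}}"
    unfolding A B using empty_in_faces by (fastforce dest: less_asym)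
  then have "sum ?h (faces ?A \<union> faces ?B) = sum ?h (faces ?A) + sum ?h (faces ?B) - 1"
    using sum.union_inter[OF finAB, of ?h] by simp
  moreover have "sum ?h (faces ?S) = 1"
    using star_sum_sphere[OF S empty_in_faces] by (simp add: star_sum_def)
  moreover have "index G g v = sum ?h (faces ?A)"
    "index G (negate_on (pverts G) g) v = sum ?h (faces ?B)"
    by (simp_all add: index_def euler_char_eq_star_sum fin star_sum_def)
  ultimately show ?thesis
    using surface_sum by simp
qed

text \<open>The index depends on \<open>g\<close> only through the set of lower neighbors, one of
  finitely many vertex sets. The resulting uniform bound gives integrability.\<close>

lemma finite_range_index:
  assumes "pair_graph G"
  shows "finite (range (\<lambda>g. index G g v))"
proof (rule finite_subset)
  show "range (\<lambda>g. index G g v) \<subseteq> (\<lambda>W. 1 - euler_char (induced G W)) ` Pow (pverts G)"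
    using pair_graph_head_in_verts[OF assms]
    by (auto simp: index_def lower_sphere_def neighbors_def)
qed (simp add: pair_graph_finite_verts[OF assms])

theorem mainTheorem14:
  fixes G :: "'a pair_pre_digraph" and M :: "('a \<Rightarrow> real) measure"
  assumes "graph_manifold 4 G"
    and "prob_space M"
    and "space M \<subseteq> locally_injective_functions G"
    and "measure_automorphism M (negate_on (pverts G))"
    and "\<And>v. v \<in> pverts G \<Longrightarrow> (\<lambda>g. real_of_int (index G g v)) \<in> borel_measurable M"
    and "\<And>v. v \<in> pverts G \<Longrightarrow> (\<lambda>g. real_of_int (euler_char (level_surface G g v))) \<in> borel_measurable M"
  shows "\<forall>v\<in>pverts G.
    index_expectation G M v = prob_space.expectation M (\<lambda>g. genus (level_surface G g v)) \<and>
    index_expectation G M v =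
      prob_space.expectation M (\<lambda>g. 1 - 1 / 2 * real_of_int (euler_char (level_surface G g v)))"
proof
  fix v assume v: "v \<in> pverts G"
  interpret prob_space M by fact
  have G: "pair_graph G" by (rule graph_manifoldD[OF assms(1)])
  have S: "graph_sphere 3 (unit_sphere G v)"
    using graph_manifoldD(3)[OF assms(1) v] by simp
  let ?T = "negate_on (pverts G)" and ?i = "\<lambda>g. real_of_int (index G g v)"
  let ?c = "\<lambda>g. real_of_int (euler_char (level_surface G g v))"
  have T: "?T \<in> measurable M M" and distr: "distr M M ?T = M"
    using assms(4) by (auto simp: measure_automorphism_def)
  have i: "?i \<in> borel_measurable M"
    by (rule assms(5)[OF v])
  have iT: "(\<lambda>g. ?i (?T g)) \<in> borel_measurable M"
    using measurable_compose[OF T i] .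
  obtain b where b: "\<And>g. \<bar>index G g v\<bar> \<le> b"
  proof -
    have "finite (abs ` range (\<lambda>g. index G g v))"
      using finite_range_index[OF G] by simp
    then have "\<bar>index G g v\<bar> \<le> Max (abs ` range (\<lambda>g. index G g v))" for g
      by (rule Max_ge) blast
    then show ?thesis by (rule that)
  qed
  have bound: "norm (?i g) \<le> real_of_int b" for g
    using b[of g] by simp
  have int: "integrable M ?i" "integrable M (\<lambda>g. ?i (?T g))"
    by (rule integrable_const_bound[where B = "real_of_int b"], use bound i iT in auto)+
  \<comment> \<open>Change of variables: negation pushes \<open>M\<close> forward to itself.\<close>
  have "expectation (\<lambda>g. ?i (?T g)) = expectation ?i"
    using integral_distr[OF T i] distr by simp
  moreover have "expectation (\<lambda>g. 1 - 1 / 2 * ?c g) = expectation (\<lambda>g. (?i g + ?i (?T g)) / 2)"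
  proof (rule Bochner_Integration.integral_cong[OF refl])
    fix g assume "g \<in> space M"
    then have "locally_injective G g"
      using assms(3) by (auto simp: locally_injective_functions_def)
    from euler_char_level_surface[OF G v S this]
    show "1 - 1 / 2 * ?c g = (?i g + ?i (?T g)) / 2" by (simp add: field_simps)
  qed
  ultimately have "index_expectation G M v = expectation (\<lambda>g. 1 - 1 / 2 * ?c g)"
    using int by (simp add: index_expectation_def)
  then show "index_expectation G M v = expectation (\<lambda>g. genus (level_surface G g v)) \<and>
    index_expectation G M v = expectation (\<lambda>g. 1 - 1 / 2 * ?c g)"
    by (simp add: genus_def)
qed

end
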